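(* Let $I=(c,d)\subset\mathbb{R}$ be an open interval, $p\in(1,\infty)$, $\nu\in\{1,2\}$, and let $w$ be a Lebesgue measurable function on $I$ with $w>0$ a.e. on $I$ and $w^p\in L^1_{\mathrm{loc},(\nu,2)}$. Let $g\in\mathfrak{M}(I)$. If the set $\{x\in I: g(x)\neq 0\}$ has positive Lebesgue measure, then $\mathbf{J}_{Ch_{p,w}(I)}(g)=\infty$, where $$\mathbf{J}_{Ch_{p,w}(I)}(g):=\sup_{h\in Ch_{p,w}(I),\,h\neq 0}\frac{\int_I|hg|}{\|h\|_{Ch_{p,w}(I)}}.$$
   Context: The interval $I=(c,d)$ may be bounded or unbounded ($-\infty\le c<d\le\infty$). $\mathfrak{M}(I)$ is the space of all Lebesgue measurable functions $f:I\to[-\infty,\infty]$ (functions equal a.e. are identified). For $x\in I$ put $I_{1,x}:=I_{2,x}^*:=(c,x]$ and $I_{1,x}^*:=I_{2,x}:=[x,d)$. For $\nu\in\{1,2\}$: $$L^1_{\mathrm{loc},(\nu,1)}:=\Big\{f\in\mathfrak{M}(I):\int_{I_{\nu,x}}|f|<\infty\ \forall x\in I\Big\},\qquad L^1_{\mathrm{loc},(\nu,2)}:=\Big\{f\in\mathfrak{M}(I):\int_{I_{\nu,x}^*}|f|<\infty\ \forall x\in I\Big\}.$$ The weighted altered Cesàro–Copson space is $Ch_{p,w}(I):=\{f\in L^1_{\mathrm{loc},(\nu,1)}:\|f\|_{Ch_{p,w}(I)}<\infty\}$, where $$\|f\|_{Ch_{p,w}(I)}:=\left(\int_I\left|w(x)\int_{I_{\nu,x}}f\right|^p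 dx\right)^{1/p}.$$ *)

theory Defs
  imports "HOL-Analysis.Analysis"
begin

text \<open>
  Elements of \<open>\<MM>(I)\<close> are represented by total functions \<^typ>\<open>real \<Rightarrow> ereal\<close>, whose values outside
  \<open>I\<close> are irrelevant. No quotient is formed: an element is nonzero if it is not a.e. zero on \<open>I\<close>.
\<close>

definition Meas :: "real set \<Rightarrow> (real \<Rightarrow> ereal) set" where
  "Meas I = borel_measurable (lebesgue_on I)"

definition seg :: "nat \<Rightarrow> real set \<Rightarrow> real \<Rightarrow> real set" where
  "seg \<nu> I x = (if \<nu> = 1 then I \<inter> {..x} else I \<inter> {x..})"

definition seg_star :: "nat \<Rightarrow> real set \<Rightarrow> real \<Rightarrow> real set" where
  "seg_star \<nu> I x = (if \<nu> = 1 then I \<inter> {x..} else I \<inter> {..x})"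

definition abs_integral :: "real set \<Rightarrow> (real \<Rightarrow> ereal) \<Rightarrow> ennreal" where
  "abs_integral A f = (\<integral>\<^sup>+x\<in>A. e2ennreal \<bar>f x\<bar> \<partial>lebesgue)"

text \<open>
  The Lebesgue integral of an extended real function as integral of the positive part minus
  integral of the negative part (\<^const>\<open>e2ennreal\<close> maps negative numbers to 0). It is used only
  where \<open>abs_integral A f < \<infinity>\<close>, so the value of \<open>\<infinity> - \<infinity>\<close> does not matter.
\<close>

definition integral_ereal :: "real set \<Rightarrow> (real \<Rightarrow> ereal) \<Rightarrow> ereal" where
  "integral_ereal A f =
     enn2ereal (\<integral>\<^sup>+x\<in>A. e2ennreal (f x) \<partial>lebesgue) -
     enn2ereal (\<integral>\<^sup>+x\<in>A. e2ennreal (- f x) \<partial>lebesgue)"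

definition L1loc1 :: "nat \<Rightarrow> real set \<Rightarrow> (real \<Rightarrow> ereal) set" where
  "L1loc1 \<nu> I = {f \<in> Meas I. \<forall>x\<in>I. abs_integral (seg \<nu> I x) f < \<infinity>}"

definition L1loc2 :: "nat \<Rightarrow> real set \<Rightarrow> (real \<Rightarrow> ereal) set" where
  "L1loc2 \<nu> I = {f \<in> Meas I. \<forall>x\<in>I. abs_integral (seg_star \<nu> I x) f < \<infinity>}"

text \<open>Powers on \<open>[0,\<infinity>]\<close>; intended for exponents \<open>p > 0\<close>.\<close>

definition epowr :: "ennreal \<Rightarrow> real \<Rightarrow> ennreal" where
  "epowr a p = (if a = \<infinity> then \<infinity> else ennreal (enn2real a powr p))"

text \<open>The function \<open>w\<^sup>p\<close> for an a.e. positive \<open>w\<close> (negative values would be replaced by 0).\<close>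

definition weight_powr :: "(real \<Rightarrow> ereal) \<Rightarrow> real \<Rightarrow> real \<Rightarrow> ereal" where
  "weight_powr w p = (\<lambda>x. enn2ereal (epowr (e2ennreal (w x)) p))"

definition Ch_norm ::
    "nat \<Rightarrow> real set \<Rightarrow> real \<Rightarrow> (real \<Rightarrow> ereal) \<Rightarrow> (real \<Rightarrow> ereal) \<Rightarrow> ennreal" where
  "Ch_norm \<nu> I p w f =
     epowr (\<integral>\<^sup>+x\<in>I. epowr (e2ennreal \<bar>w x * integral_ereal (seg \<nu> I x) f\<bar>) p \<partial>lebesgue) (1 / p)"

definition Ch :: "nat \<Rightarrow> real set \<Rightarrow> real \<Rightarrow> (real \<Rightarrow> ereal) \<Rightarrow> (real \<Rightarrow> ereal) set" where
  "Ch \<nu> I p w = {f \<in> L1loc1 \<nu> I. Ch_norm \<nu> I p w f < \<infinity>}"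

definition J_Ch ::
    "nat \<Rightarrow> real set \<Rightarrow> real \<Rightarrow> (real \<Rightarrow> ereal) \<Rightarrow> (real \<Rightarrow> ereal) \<Rightarrow> ennreal" where
  "J_Ch \<nu> I p w g =
     (SUP h\<in>{h \<in> Ch \<nu> I p w. \<not> (AE x in lebesgue_on I. h x = 0)}.
        abs_integral I (\<lambda>x. h x * g x) / Ch_norm \<nu> I p w h)"

end

theory Submission
  imports Defs
begin

text \<open>
  The norm of \<open>Ch\<^sub>p\<^sub>,\<^sub>w\<close> only sees the primitive of a function, whereas \<open>\<integral>|h g|\<close> only sees its absolute
  value, so fast sign changes make the quotient blow up. Take a bounded set \<open>A\<close> of positive measure,
  with \<open>|g| \<ge> \<epsilon>\<close> on \<open>A\<close>, inside a compact subinterval of \<open>I\<close>, and let \<open>h = s\<close> on \<open>A\<close> and \<open>h = 0\<close>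
  off \<open>A\<close>, where \<open>s\<close> takes only the values \<open>1\<close> and \<open>-1\<close>. Then \<open>\<integral>|h g| \<ge> \<epsilon> |A|\<close>, whatever the signs
  are. On the other hand, for each \<open>\<delta> > 0\<close> the signs can be chosen such that the integrals of \<open>h\<close>
  over all half-lines are at most \<open>\<delta>\<close> in absolute value (\<open>exists_balanced_signs\<close>). Let \<open>e\<close> be the left
  end of the compact interval for \<open>\<nu> = 1\<close> and the right end for \<open>\<nu> = 2\<close>. The integral of \<open>h\<close> over
  \<open>I\<^sub>\<nu>\<^sub>,\<^sub>x\<close> vanishes unless \<open>x \<in> I\<^sub>\<nu>\<^sub>,\<^sub>e\<^sup>*\<close>, since otherwise \<open>I\<^sub>\<nu>\<^sub>,\<^sub>x\<close> does not meet \<open>A\<close>. Hence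
  \<open>\<parallel>h\<parallel> \<le> \<delta> (\<integral> w\<^sup>p)\<^bsup>1/p\<^esup>\<close> with the integral over \<open>I\<^sub>\<nu>\<^sub>,\<^sub>e\<^sup>*\<close>, which is finite by the hypothesis on
  \<open>w\<close> (\<open>Ch_norm_le\<close>). Now let \<open>\<delta>\<close> tend to \<open>0\<close>.
\<close>

section \<open>Sign functions with small partial integrals\<close>

lemma set_integrable_sign:
  fixes s :: "real \<Rightarrow> real"
  assumes "B \<in> sets lebesgue" "emeasure lebesgue B < \<infinity>"
    and "s \<in> borel_measurable borel" "\<And>x. \<bar>s x\<bar> = 1"
  shows "set_integrable lebesgue B s"
proof -
  have [measurable]: "s \<in> borel_measurable lebesgue"
    using assms(3) by (intro measurable_completion) simp
  show ?thesis
    unfolding set_integrable_def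
    by (rule integrableI_bounded_set_indicator[where B = 1]) (use assms in auto)
qed

lemma emeasure_subset_Icc_finite:
  fixes B :: "real set"
  assumes "B \<subseteq> {a..b}"
  shows "emeasure lebesgue B < \<infinity>"
proof -
  have "emeasure lebesgue B \<le> emeasure lebesgue {a..b}"
    using assms by (intro emeasure_mono) auto
  also have "\<dots> < \<infinity>" by (cases "a \<le> b") auto
  finally show ?thesis .
qed

text \<open>
  The signs are chosen greedily on consecutive intervals of length \<open>\<delta>\<close>: on each interval the sign is
  constant and opposite to the sign of the integral accumulated before it. An interval changes the
  accumulated integral by at most \<open>\<delta>\<close>, so it stays in \<open>[-\<delta>, \<delta>]\<close>.
\<close>

lemma exists_balanced_signs_upto:
  fixes A :: "real set" and \<delta> :: real
  assumes A: "A \<in> sets lebesgue" "A \<subseteq> {a..}" and "\<delta> > 0"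
  shows "\<exists>s \<in> borel_measurable borel. (\<forall>x. \<bar>s x\<bar> = (1::real)) \<and>
           (\<forall>x \<le> a + real n * \<delta>. \<bar>LINT y:A \<inter> {..x}|lebesgue. s y\<bar> \<le> \<delta>)"
proof (induction n)
  case 0
  have "(LINT y:A \<inter> {..x}|lebesgue. 1) = (0::real)" if "x \<le> a" for x :: real
  proof -
    have "A \<inter> {..x} \<subseteq> {a}" using that A by auto
    then have "A \<inter> {..x} = {} \<or> A \<inter> {..x} = {a}" by blast
    then have "measure lebesgue (A \<inter> {..x}) = 0" by auto
    then show ?thesis by (simp add: set_lebesgue_integral_def)
  qed
  then show ?case using \<open>\<delta> > 0\<close> by (intro bexI[of _ "\<lambda>_. 1"]) auto
next
  case (Suc n)
  then obtain s :: "real \<Rightarrow> real" where s [measurable]: "s \<in> borel_measurable borel"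
    and s1: "\<And>x. \<bar>s x\<bar> = 1"
    and bound: "\<And>x. x \<le> a + real n * \<delta> \<Longrightarrow> \<bar>LINT y:A \<inter> {..x}|lebesgue. s y\<bar> \<le> \<delta>"
    by blast
  define t where "t = a + real n * \<delta>"
  define S where "S = (LINT y:A \<inter> {..t}|lebesgue. s y)"
  define \<sigma> :: real where "\<sigma> = (if S \<ge> 0 then -1 else 1)"
  define s' where "s' y = (if y \<le> t then s y else \<sigma>)" for y
  have s' [measurable]: "s' \<in> borel_measurable borel"
    unfolding s'_def by measurable
  have s'1: "\<bar>s' x\<bar> = 1" for x
    using s1 by (simp add: s'_def \<sigma>_def)
  have old: "(LINT y:A \<inter> {..x}|lebesgue. s' y) = (LINT y:A \<inter> {..x}|lebesgue. s y)" if "x \<le> t" for x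
    using that A by (intro set_lebesgue_integral_cong) (auto simp: s'_def)
  have "\<bar>LINT y:A \<inter> {..x}|lebesgue. s' y\<bar> \<le> \<delta>" if x: "x \<le> a + real (Suc n) * \<delta>" for x
  proof (cases "x \<le> t")
    case True
    then show ?thesis using old bound by (simp add: t_def)
  next
    case False
    define B where "B = A \<inter> {t<..x}"
    have B: "B \<in> sets lebesgue" using A by (auto simp: B_def)
    have Bfin: "emeasure lebesgue B < \<infinity>"
      by (rule emeasure_subset_Icc_finite[of _ t x]) (auto simp: B_def)
    define m where "m = measure lebesgue B"
    have "m \<le> measure lebesgue {t<..x}"
      unfolding m_def using B False
      by (intro measure_mono_fmeasurable) (auto simp: B_def fmeasurable_def)
    also have "\<dots> \<le> \<delta>" using False x by (simp add: t_def algebra_simps)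
    finally have m: "m \<le> \<delta>" .
    have "A \<inter> {..x} = (A \<inter> {..t}) \<union> B" using False by (auto simp: B_def)
    moreover have "set_integrable lebesgue (A \<inter> {..t}) s'"
    proof (rule set_integrable_sign)
      show "emeasure lebesgue (A \<inter> {..t}) < \<infinity>"
        using A by (intro emeasure_subset_Icc_finite[of _ a t]) auto
    qed (use A s' s'1 in auto)
    moreover have "set_integrable lebesgue B s'"
      using B Bfin s' s'1 by (intro set_integrable_sign) auto
    moreover have "(A \<inter> {..t}) \<inter> B = {}" by (auto simp: B_def)
    ultimately have "(LINT y:A \<inter> {..x}|lebesgue. s' y)
        = (LINT y:A \<inter> {..t}|lebesgue. s' y) + (LINT y:B|lebesgue. s' y)"
      by (simp add: set_integral_Un)
    also have "(LINT y:A \<inter> {..t}|lebesgue. s' y) = S" using old by (simp add: S_def)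
    also have "(LINT y:B|lebesgue. s' y) = (LINT y:B|lebesgue. \<sigma>)"
      using B by (intro set_lebesgue_integral_cong) (auto simp: s'_def B_def)
    also have "\<dots> = m * \<sigma>"
      using B Bfin by (simp add: set_integral_const m_def)
    finally have "(LINT y:A \<inter> {..x}|lebesgue. s' y) = S + m * \<sigma>" .
    moreover have "\<bar>S\<bar> \<le> \<delta>" using bound by (simp add: S_def t_def)
    moreover have "0 \<le> m" by (simp add: m_def)
    ultimately show ?thesis using m by (auto simp: \<sigma>_def)
  qed
  with s' s'1 show ?case by blast
qed

lemma exists_balanced_signs:
  fixes A :: "real set" and \<delta> :: real
  assumes A: "A \<in> sets lebesgue" "A \<subseteq> {a..b}" and "\<delta> > 0"
  shows "\<exists>s \<in> borel_measurable borel. (\<forall>x. \<bar>s x\<bar> = (1::real)) \<and>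
           (\<forall>x. \<bar>LINT y:A \<inter> {..x}|lebesgue. s y\<bar> \<le> \<delta>) \<and>
           (\<forall>x. \<bar>LINT y:A \<inter> {x..}|lebesgue. s y\<bar> \<le> \<delta>)"
proof -
  obtain n where n: "b - a \<le> real n * (\<delta>/2)"
    using reals_Archimedean3[of "\<delta>/2"] \<open>\<delta> > 0\<close> by (metis half_gt_zero less_imp_le)
  have "A \<subseteq> {a..}" using A by auto
  (* A right tail is the total minus a left tail, so it costs twice the bound: hence \<delta>/2 here. *)
  from exists_balanced_signs_upto[OF A(1) this, of "\<delta>/2" n] \<open>\<delta> > 0\<close>
  obtain s :: "real \<Rightarrow> real" where s [measurable]: "s \<in> borel_measurable borel"
    and s1: "\<And>x. \<bar>s x\<bar> = 1"
    and bound: "\<And>x. x \<le> a + real n * (\<delta>/2) \<Longrightarrow> \<bar>LINT y:A \<inter> {..x}|lebesgue. s y\<bar> \<le> \<delta>/2"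
    by auto
  have int: "set_integrable lebesgue B s" if "B \<in> sets lebesgue" "B \<subseteq> A" for B
    using that A s s1 emeasure_subset_Icc_finite[of B a b]
    by (intro set_integrable_sign) auto
  have left: "\<bar>LINT y:A \<inter> {..x}|lebesgue. s y\<bar> \<le> \<delta>/2" for x
  proof (cases "x \<le> b")
    case True
    with n bound show ?thesis by auto
  next
    case False
    then have "A \<inter> {..x} = A \<inter> {..b}" using A by auto
    then show ?thesis using n bound[of b] by simp
  qed
  have "\<bar>LINT y:A \<inter> {x..}|lebesgue. s y\<bar> \<le> \<delta>" for x
  proof -
    have cut: "A \<inter> {..<x} \<in> sets lebesgue" "A \<inter> {..x} \<in> sets lebesgue" using A by auto
    have "A = (A \<inter> {..<x}) \<union> (A \<inter> {x..})" by auto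
    then have "(LINT y:A|lebesgue. s y)
        = (LINT y:(A \<inter> {..<x}) \<union> (A \<inter> {x..})|lebesgue. s y)" by simp
    also have "\<dots> = (LINT y:A \<inter> {..<x}|lebesgue. s y) + (LINT y:A \<inter> {x..}|lebesgue. s y)"
      using A by (intro set_integral_Un int) auto
    also have "(LINT y:A \<inter> {..<x}|lebesgue. s y) = (LINT y:A \<inter> {..x}|lebesgue. s y)"
    proof (rule set_integral_cong_set)
      show "set_borel_measurable lebesgue (A \<inter> {..<x}) s" "set_borel_measurable lebesgue (A \<inter> {..x}) s"
        using A int[of "A \<inter> {..<x}"] int[of "A \<inter> {..x}"] cut
        unfolding set_integrable_def set_borel_measurable_def
        by (simp_all add: borel_measurable_integrable)
      show "AE y in lebesgue. y \<in> A \<inter> {..x} \<longleftrightarrow> y \<in> A \<inter> {..<x}"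
        by (rule AE_I'[of "{x}"]) auto
    qed
    finally have "(LINT y:A \<inter> {x..}|lebesgue. s y)
        = (LINT y:A|lebesgue. s y) - (LINT y:A \<inter> {..x}|lebesgue. s y)" by simp
    moreover have "A \<inter> {..b} = A" using A by auto
    ultimately show ?thesis using left[of x] left[of b] by simp
  qed
  moreover have "\<bar>LINT y:A \<inter> {..x}|lebesgue. s y\<bar> \<le> \<delta>" for x
    using left[of x] \<open>\<delta> > 0\<close> by linarith
  ultimately show ?thesis using s s1 by blast
qed

section \<open>Powers and integrals of extended real functions\<close>

lemma epowr_mono:
  assumes "a \<le> b" "p > 0"
  shows "epowr a p \<le> epowr b p"
proof (cases "b = \<infinity>")
  case False
  then have "enn2real a \<le> enn2real b" "a \<noteq> \<infinity>"
    using assms by (auto simp: enn2real_mono top.not_eq_extremum intro: le_less_trans)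
  then show ?thesis
    using False assms by (auto simp: epowr_def intro!: ennreal_leI powr_mono2)
qed (simp add: epowr_def)

lemma epowr_mult_ennreal:
  assumes "r > 0"
  shows "epowr (a * ennreal r) p = epowr a p * ennreal (r powr p)"
proof (cases a)
  case (real x)
  then have "a * ennreal r = ennreal (x * r)" using assms by (simp add: ennreal_mult)
  with real assms show ?thesis
    by (simp add: epowr_def powr_mult ennreal_mult[symmetric])
next
  case top
  then show ?thesis using assms by (simp add: epowr_def ennreal_top_mult)
qed

lemma ennreal_divide_mono:
  fixes a b x y :: ennreal
  assumes "a \<le> b" "x \<le> y"
  shows "a / y \<le> b / x"
proof -
  have "inverse y \<le> inverse x"
    using assms(2) by (simp add: less_eq_ennreal.rep_eq inverse_ennreal.rep_eq ereal_inverse_antimono)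
  with assms(1) show ?thesis
    unfolding divide_ennreal_def by (intro mult_mono) auto
qed

lemma integral_ereal_eq_LINT:
  fixes f :: "real \<Rightarrow> real"
  assumes "set_integrable lebesgue B f"
  shows "integral_ereal B (\<lambda>x. ereal (f x)) = ereal (LINT x:B|lebesgue. f x)"
proof -
  let ?F = "\<lambda>x. indicator B x * f x"
  have int: "integrable lebesgue ?F"
    using assms by (simp add: set_integrable_def)
  have pos: "(\<integral>\<^sup>+x\<in>B. e2ennreal (ereal (f x)) \<partial>lebesgue) = (\<integral>\<^sup>+x. ennreal (?F x) \<partial>lebesgue)"
    by (intro nn_integral_cong) (auto simp: indicator_def)
  have neg: "(\<integral>\<^sup>+x\<in>B. e2ennreal (- ereal (f x)) \<partial>lebesgue) = (\<integral>\<^sup>+x. ennreal (- ?F x) \<partial>lebesgue)"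
    by (intro nn_integral_cong) (auto simp: indicator_def)
  have fin: "(\<integral>\<^sup>+x. ennreal (?F x) \<partial>lebesgue) \<noteq> \<infinity>" "(\<integral>\<^sup>+x. ennreal (- ?F x) \<partial>lebesgue) \<noteq> \<infinity>"
    using int by (auto simp: real_integrable_def)
  have "(LINT x:B|lebesgue. f x) = enn2real (\<integral>\<^sup>+x. ennreal (?F x) \<partial>lebesgue)
      - enn2real (\<integral>\<^sup>+x. ennreal (- ?F x) \<partial>lebesgue)"
    using real_lebesgue_integral_def[OF int] by (simp add: set_lebesgue_integral_def)
  moreover have "enn2ereal u = ereal (enn2real u)" if "u \<noteq> \<infinity>" for u :: ennreal
    using that by (cases u) auto
  ultimately show ?thesis
    using fin unfolding integral_ereal_def pos neg by simp
qed

section \<open>Test functions with large pairing and small norm\<close>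

text \<open>
  Only the weight on the one-sided interval \<open>I\<^sub>\<nu>\<^sub>,\<^sub>a\<^sup>*\<close> enters, because the primitive of \<open>f\<close>
  vanishes elsewhere; \<open>w\<^sup>p \<in> L\<^sup>1\<^sub>l\<^sub>o\<^sub>c\<^sub>,\<^sub>(\<^sub>\<nu>\<^sub>,\<^sub>2\<^sub>)\<close> says that the weight is integrable there
  for every \<open>a \<in> I\<close>.
\<close>

lemma Ch_norm_le:
  assumes "p > 0" "\<delta> > 0"
    and w: "AE x in lebesgue_on I. w x > 0" "weight_powr w p \<in> Meas I"
    and I: "I \<in> sets lebesgue"
    and le: "\<And>x. x \<in> I \<Longrightarrow> \<bar>integral_ereal (seg \<nu> I x) f\<bar> \<le> ereal \<delta>"
    and zero: "\<And>x. x \<in> I \<Longrightarrow> x \<notin> seg_star \<nu> I a \<Longrightarrow> integral_ereal (seg \<nu> I x) f = 0"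
  shows "Ch_norm \<nu> I p w f
           \<le> ennreal \<delta> * epowr (abs_integral (seg_star \<nu> I a) (weight_powr w p)) (1 / p)"
proof -
  let ?W = "weight_powr w p" and ?P = "\<lambda>x. integral_ereal (seg \<nu> I x) f"
  let ?B = "seg_star \<nu> I a"
  have pw: "epowr (e2ennreal \<bar>w x * ?P x\<bar>) p * indicator I x
      \<le> ennreal (\<delta> powr p) * (e2ennreal \<bar>?W x\<bar> * indicator ?B x)" if "x \<in> I \<Longrightarrow> w x > 0" for x
  proof (cases "x \<in> I \<and> x \<in> ?B")
    case True
    have wx: "w x > 0" using True that by simp
    have "\<bar>w x * ?P x\<bar> \<le> w x * ereal \<delta>"
      using le[of x] True wx by (simp add: ereal_abs_mult ereal_mult_left_mono)
    then have "e2ennreal \<bar>w x * ?P x\<bar> \<le> e2ennreal (w x * ereal \<delta>)" by (rule e2ennreal_mono)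
    also have "\<dots> = e2ennreal (w x) * ennreal \<delta>"
    proof -
      obtain u where "w x = enn2ereal u" using wx by (cases "w x" rule: ereal_ennreal_cases) auto
      then have "w x * ereal \<delta> = enn2ereal (u * ennreal \<delta>)"
        using \<open>\<delta> > 0\<close> by (simp add: times_ennreal.rep_eq)
      then show ?thesis using \<open>w x = enn2ereal u\<close> by simp
    qed
    finally have "epowr (e2ennreal \<bar>w x * ?P x\<bar>) p \<le> epowr (e2ennreal (w x) * ennreal \<delta>) p"
      using \<open>p > 0\<close> by (intro epowr_mono) auto
    also have "\<dots> = epowr (e2ennreal (w x)) p * ennreal (\<delta> powr p)"
      using \<open>\<delta> > 0\<close> by (rule epowr_mult_ennreal)
    also have "epowr (e2ennreal (w x)) p = e2ennreal \<bar>?W x\<bar>"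
      by (simp add: weight_powr_def)
    finally show ?thesis using True by (simp add: mult.commute)
  next
    case False
    show ?thesis
    proof (cases "x \<in> I")
      case True
      (* Infinite values of w do no harm here: the product of infinity and 0 is 0 in ereal. *)
      then show ?thesis using False zero[of x] \<open>p > 0\<close>
        by (simp add: epowr_def e2ennreal_neg)
    qed simp
  qed
  have AE: "AE x in lebesgue. x \<in> I \<longrightarrow> w x > 0"
    using w(1) I by (subst (asm) AE_restrict_space_iff) auto
  have B: "?B \<in> sets lebesgue" "?B \<subseteq> I" using I by (auto simp: seg_star_def)
  have "?W \<in> borel_measurable (lebesgue_on I)"
    using w(2) by (simp add: Meas_def)
  then have "(\<lambda>x. e2ennreal \<bar>?W x\<bar>) \<in> borel_measurable (lebesgue_on I)" by measurable
  then have "(\<lambda>x. e2ennreal \<bar>?W x\<bar>) \<in> borel_measurable (lebesgue_on ?B)"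
    using B by (rule_tac measurable_restrict_mono)
  then have meas: "(\<lambda>x. e2ennreal \<bar>?W x\<bar> * indicator ?B x) \<in> borel_measurable lebesgue"
    using B by (subst (asm) borel_measurable_restrict_space_iff_ennreal) auto
  have "(\<integral>\<^sup>+x\<in>I. epowr (e2ennreal \<bar>w x * ?P x\<bar>) p \<partial>lebesgue)
      \<le> (\<integral>\<^sup>+x. ennreal (\<delta> powr p) * (e2ennreal \<bar>?W x\<bar> * indicator ?B x) \<partial>lebesgue)"
    using AE by (intro nn_integral_mono_AE) (auto elim!: eventually_mono intro: pw)
  also have "\<dots> = abs_integral ?B ?W * ennreal (\<delta> powr p)"
    using meas by (simp add: nn_integral_cmult abs_integral_def mult.commute)
  finally have "Ch_norm \<nu> I p w f \<le> epowr (abs_integral ?B ?W * ennreal (\<delta> powr p)) (1 / p)"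
    unfolding Ch_norm_def using \<open>p > 0\<close> by (intro epowr_mono) auto
  also have "\<dots> = epowr (abs_integral ?B ?W) (1 / p) * ennreal ((\<delta> powr p) powr (1 / p))"
    using \<open>\<delta> > 0\<close> by (intro epowr_mult_ennreal) auto
  also have "(\<delta> powr p) powr (1 / p) = \<delta>"
    using \<open>p > 0\<close> \<open>\<delta> > 0\<close> by (simp add: powr_powr)
  finally show ?thesis by (simp add: mult.commute)
qed

text \<open>
  The set \<open>{g \<noteq> 0}\<close> is covered by the countably many sets where \<open>|g| \<ge> 1/(n+1)\<close> inside the \<open>i\<close>-th
  interval of a compact exhaustion of \<open>(c, d)\<close>, so these cannot all be null.
\<close>

lemma exists_bounded_below_subset:
  fixes c d :: ereal and g :: "real \<Rightarrow> ereal"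
  assumes "c < d" "g \<in> Meas (einterval c d)"
    and pos: "emeasure lebesgue {x \<in> einterval c d. g x \<noteq> 0} > 0"
  obtains A a b \<epsilon> where "A \<in> sets lebesgue" "emeasure lebesgue A > 0" "A \<subseteq> {a..b}"
    "{a..b} \<subseteq> einterval c d" "a \<in> einterval c d" "b \<in> einterval c d"
    "\<epsilon> > (0::real)" "\<And>x. x \<in> A \<Longrightarrow> ereal \<epsilon> \<le> \<bar>g x\<bar>"
proof -
  let ?I = "einterval c d"
  obtain u l :: "nat \<Rightarrow> real" where ul: "?I = (\<Union>i. {l i .. u i})" "\<And>i. l i < u i"
    by (rule einterval_Icc_approximation[OF \<open>c < d\<close>]) (rule that; assumption)
  define A where "A = (\<lambda>(i, n). {x \<in> {l i .. u i}. ereal (1 / real (Suc n)) \<le> \<bar>g x\<bar>})"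
  have g [measurable]: "g \<in> borel_measurable (lebesgue_on ?I)"
    using assms(2) by (simp add: Meas_def)
  have A: "A k \<in> sets lebesgue" for k
  proof (cases k)
    case (Pair i n)
    have "{x \<in> space (lebesgue_on ?I). ereal (1 / real (Suc n)) \<le> \<bar>g x\<bar>} \<in> sets (lebesgue_on ?I)"
      by measurable
    then have "{x \<in> ?I. ereal (1 / real (Suc n)) \<le> \<bar>g x\<bar>} \<in> sets lebesgue"
      by (subst (asm) sets_restrict_space_iff) (auto simp: space_restrict_space)
    then have "{l i .. u i} \<inter> {x \<in> ?I. ereal (1 / real (Suc n)) \<le> \<bar>g x\<bar>} \<in> sets lebesgue"
      by auto
    also have "{l i .. u i} \<inter> {x \<in> ?I. ereal (1 / real (Suc n)) \<le> \<bar>g x\<bar>} = A k"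
      using ul Pair by (auto simp: A_def)
    finally show ?thesis .
  qed
  have "{x \<in> ?I. g x \<noteq> 0} \<subseteq> (\<Union>k. A k)"
  proof
    fix x assume x: "x \<in> {x \<in> ?I. g x \<noteq> 0}"
    then obtain i where i: "x \<in> {l i .. u i}" using ul by auto
    have "\<exists>n. ereal (1 / real (Suc n)) \<le> \<bar>g x\<bar>"
    proof (cases "g x")
      case (real r)
      then have "r \<noteq> 0" using x by auto
      then obtain n where "inverse (real (Suc n)) < \<bar>r\<bar>"
        using reals_Archimedean[of "\<bar>r\<bar>"] by auto
      then show ?thesis using real by (auto simp: inverse_eq_divide intro!: exI[of _ n])
    qed auto
    then obtain n where "ereal (1 / real (Suc n)) \<le> \<bar>g x\<bar>" ..
    then have "x \<in> A (i, n)" using i by (simp add: A_def)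
    then show "x \<in> (\<Union>k. A k)" by blast
  qed
  moreover have "(\<Union>k. A k) \<in> sets lebesgue" using A by blast
  ultimately have "emeasure lebesgue {x \<in> ?I. g x \<noteq> 0} \<le> emeasure lebesgue (\<Union>k. A k)"
    by (rule emeasure_mono)
  with pos have "(\<Union>k. A k) \<notin> null_sets lebesgue" by auto
  then obtain k where "A k \<notin> null_sets lebesgue" by blast
  then have k: "emeasure lebesgue (A k) \<noteq> 0" using A null_setsI by blast
  obtain i n where in_eq: "k = (i, n)" by (cases k)
  show thesis
  proof (rule that[of "A k" "l i" "u i" "1 / real (Suc n)"])
    show "{l i .. u i} \<subseteq> ?I" using ul by blast
    then show "l i \<in> ?I" "u i \<in> ?I" using ul(2)[of i] by auto
    show "emeasure lebesgue (A k) > 0" using k by (simp add: zero_less_iff_neq_zero)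
  qed (use A in \<open>auto simp: A_def in_eq\<close>)
qed

text \<open>
  The test function is a balanced sign function cut off to \<open>A\<close>. It has modulus \<open>1\<close> on \<open>A\<close>, so the
  lower bound on its pairing with \<open>g\<close> does not depend on \<open>\<delta>\<close>. The point \<open>e\<close> is the end of \<open>[a, b]\<close>
  that the growing interval \<open>I\<^sub>\<nu>\<^sub>,\<^sub>x\<close> reaches first.
\<close>

lemma exists_small_norm_test_function:
  fixes c d :: ereal and g w :: "real \<Rightarrow> ereal"
  defines "I \<equiv> einterval c d"
  assumes "p > 0" "\<delta> > 0"
    and w: "AE x in lebesgue_on I. w x > 0" "weight_powr w p \<in> L1loc2 \<nu> I"
    and A: "A \<in> sets lebesgue" "emeasure lebesgue A > 0" "A \<subseteq> {a..b}" "{a..b} \<subseteq> I"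
    and \<epsilon>: "\<epsilon> > (0::real)" "\<And>x. x \<in> A \<Longrightarrow> ereal \<epsilon> \<le> \<bar>g x\<bar>"
  defines "e \<equiv> (if \<nu> = 1 then a else b)"
  assumes e: "e \<in> I"
  shows "\<exists>h \<in> Ch \<nu> I p w. \<not> (AE x in lebesgue_on I. h x = 0) \<and>
           Ch_norm \<nu> I p w h
             \<le> ennreal \<delta> * epowr (abs_integral (seg_star \<nu> I e) (weight_powr w p)) (1 / p) \<and>
           ennreal \<epsilon> * emeasure lebesgue A \<le> abs_integral I (\<lambda>x. h x * g x)"
proof -
  let ?W = "weight_powr w p"
  have I: "I \<in> sets lebesgue" by (simp add: I_def)
  have AI: "A \<subseteq> I" using A by blast
  obtain s :: "real \<Rightarrow> real" where s: "s \<in> borel_measurable borel"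
    and s1: "\<And>x. \<bar>s x\<bar> = 1"
    and left: "\<And>x. \<bar>LINT y:A \<inter> {..x}|lebesgue. s y\<bar> \<le> \<delta>"
    and right: "\<And>x. \<bar>LINT y:A \<inter> {x..}|lebesgue. s y\<bar> \<le> \<delta>"
    using exists_balanced_signs[OF A(1,3) \<open>\<delta> > 0\<close>] by blast
  have [measurable]: "s \<in> borel_measurable lebesgue"
    using s by (intro measurable_completion) simp
  define f where "f x = indicator A x * s x" for x
  define h where "h x = ereal (f x)" for x
  have fm [measurable]: "f \<in> borel_measurable lebesgue"
    unfolding f_def using A(1) by measurable
  have hm: "h \<in> Meas I"
    unfolding Meas_def h_def by (intro measurable_restrict_space1) measurable
  define T where "T x = (if \<nu> = 1 then A \<inter> {..x} else A \<inter> {x..})" for x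
  have segT: "seg \<nu> I x \<inter> A = T x" for x
    using AI by (auto simp: seg_def T_def)
  have Tint: "set_integrable lebesgue (T x) s" for x
  proof (rule set_integrable_sign)
    show "T x \<in> sets lebesgue" using A by (auto simp: T_def)
    show "emeasure lebesgue (T x) < \<infinity>"
      using A by (intro emeasure_subset_Icc_finite[of _ a b]) (auto simp: T_def)
  qed (use s s1 in auto)
  have prim: "integral_ereal (seg \<nu> I x) h = ereal (LINT y:T x|lebesgue. s y)" for x
  proof -
    have eq: "indicat_real (seg \<nu> I x) y * f y = indicat_real (T x) y * s y" for y
      by (auto simp: f_def segT[symmetric] indicator_def)
    show ?thesis
      unfolding h_def using Tint[of x]
      by (subst integral_ereal_eq_LINT) (simp_all add: set_integrable_def set_lebesgue_integral_def eq)
  qed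
  have norm_le: "Ch_norm \<nu> I p w h \<le> ennreal \<delta> * epowr (abs_integral (seg_star \<nu> I e) ?W) (1 / p)"
  proof (rule Ch_norm_le)
    show "?W \<in> Meas I" using w(2) by (simp add: L1loc2_def)
    show "\<bar>integral_ereal (seg \<nu> I x) h\<bar> \<le> ereal \<delta>" for x
      using left[of x] right[of x] by (simp add: prim T_def)
    show "integral_ereal (seg \<nu> I x) h = 0" if "x \<in> I" "x \<notin> seg_star \<nu> I e" for x
    proof -
      have "T x = {}" using that A(3) by (auto simp: T_def seg_star_def e_def split: if_splits)
      then show ?thesis by (simp add: prim zero_ereal_def set_lebesgue_integral_def)
    qed
  qed (use assms I in auto)
  have "abs_integral (seg_star \<nu> I e) ?W < \<infinity>"
    using w(2) e by (simp add: L1loc2_def)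
  then have "epowr (abs_integral (seg_star \<nu> I e) ?W) (1 / p) < \<infinity>"
    by (simp add: epowr_def)
  with norm_le have "Ch_norm \<nu> I p w h < \<infinity>"
    by (auto simp: ennreal_mult_less_top intro: le_less_trans)
  moreover have "abs_integral (seg \<nu> I x) h < \<infinity>" for x
  proof -
    have "abs_integral (seg \<nu> I x) h \<le> (\<integral>\<^sup>+y. indicator A y \<partial>lebesgue)"
      unfolding abs_integral_def
      using s1 by (intro nn_integral_mono) (auto simp: h_def f_def indicator_def)
    also have "\<dots> < \<infinity>" using A emeasure_subset_Icc_finite[OF A(3)] by simp
    finally show ?thesis .
  qed
  ultimately have "h \<in> Ch \<nu> I p w"
    using hm by (simp add: Ch_def L1loc1_def)
  moreover have "\<not> (AE x in lebesgue_on I. h x = 0)"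
  proof
    assume "AE x in lebesgue_on I. h x = 0"
    then have "AE x in lebesgue. x \<in> I \<longrightarrow> h x = 0"
      using I by (subst (asm) AE_restrict_space_iff) auto
    moreover have "h x \<noteq> 0" if "x \<in> A" for x
      using that s1[of x] by (auto simp: h_def f_def)
    ultimately have "AE x in lebesgue. x \<notin> A"
      using AI by (auto elim!: eventually_mono)
    then have "emeasure lebesgue A = 0"
      using A(1) by (subst (asm) AE_iff_measurable[of A]) auto
    with A(2) show False by simp
  qed
  moreover have "ennreal \<epsilon> * emeasure lebesgue A \<le> abs_integral I (\<lambda>x. h x * g x)"
  proof -
    have "ennreal \<epsilon> * emeasure lebesgue A = (\<integral>\<^sup>+x. ennreal \<epsilon> * indicator A x \<partial>lebesgue)"
      using A(1) by (simp add: nn_integral_cmult_indicator)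
    also have "\<dots> \<le> abs_integral I (\<lambda>x. h x * g x)"
      unfolding abs_integral_def
    proof (intro nn_integral_mono)
      fix x
      show "ennreal \<epsilon> * indicator A x \<le> e2ennreal \<bar>h x * g x\<bar> * indicator I x"
      proof (cases "x \<in> A")
        case True
        then have "\<bar>h x * g x\<bar> = \<bar>g x\<bar>"
          using s1[of x] by (simp add: ereal_abs_mult h_def f_def one_ereal_def[symmetric])
        moreover have "ennreal \<epsilon> \<le> e2ennreal \<bar>g x\<bar>"
          using e2ennreal_mono[OF \<epsilon>(2)[OF True]] by simp
        ultimately show ?thesis using True AI by auto
      qed simp
    qed
    finally show ?thesis .
  qed
  ultimately show ?thesis using norm_le by blast
qed

theorem corollary2p2:
  fixes c d :: ereal and p :: real and \<nu> :: nat and w g :: "real \<Rightarrow> ereal"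
  defines "I \<equiv> einterval c d"
  assumes "c < d"
    and "1 < p"
    and "\<nu> \<in> {1, 2}"
    and "w \<in> Meas I"
    and "AE x in lebesgue_on I. w x > 0"
    and "weight_powr w p \<in> L1loc2 \<nu> I"
    and "g \<in> Meas I"
    and "emeasure lebesgue {x \<in> I. g x \<noteq> 0} > 0"
  shows "J_Ch \<nu> I p w g = \<infinity>"
proof -
  obtain A a b \<epsilon> where A: "A \<in> sets lebesgue" "emeasure lebesgue A > 0" "A \<subseteq> {a..b}" "{a..b} \<subseteq> I"
    and ab: "a \<in> I" "b \<in> I"
    and \<epsilon>: "\<epsilon> > (0::real)" "\<And>x. x \<in> A \<Longrightarrow> ereal \<epsilon> \<le> \<bar>g x\<bar>"
    using exists_bounded_below_subset[OF \<open>c < d\<close> assms(8,9)[unfolded I_def], folded I_def] by blast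
  define e where "e = (if \<nu> = 1 then a else b)"
  have e: "e \<in> I" using ab by (simp add: e_def)
  define K where "K = epowr (abs_integral (seg_star \<nu> I e) (weight_powr w p)) (1 / p)"
  define k where "k = enn2real K"
  have "abs_integral (seg_star \<nu> I e) (weight_powr w p) < \<infinity>"
    using assms(7) e by (simp add: L1loc2_def)
  then have K: "K = ennreal k" "k \<ge> 0"
    by (auto simp: K_def k_def epowr_def)
  define m where "m = measure lebesgue A"
  have m: "emeasure lebesgue A = ennreal m" "m > 0"
  proof -
    show "emeasure lebesgue A = ennreal m"
      using emeasure_subset_Icc_finite[OF A(3)] by (simp add: m_def emeasure_eq_ennreal_measure)
    with A(2) show "m > 0" by simp
  qed
  have "p > 0" using \<open>1 < p\<close> by simp
  have "ennreal r \<le> J_Ch \<nu> I p w g" if "r > 0" for r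
  proof -
    (* This choice of \<delta> makes the lower bound \<epsilon> * m / (\<delta> * (k + 1)) of the quotient equal to r;
       the summand 1 allows for k = 0. *)
    define \<delta> where "\<delta> = \<epsilon> * m / (r * (k + 1))"
    have \<delta>: "\<delta> > 0" using \<epsilon>(1) m(2) K(2) \<open>r > 0\<close> by (simp add: \<delta>_def)
    obtain h where h: "h \<in> Ch \<nu> I p w" "\<not> (AE x in lebesgue_on I. h x = 0)"
      and norm: "Ch_norm \<nu> I p w h \<le> ennreal \<delta> * K"
      and pair: "ennreal \<epsilon> * emeasure lebesgue A \<le> abs_integral I (\<lambda>x. h x * g x)"
      using exists_small_norm_test_function[of p \<delta> w c d \<nu> A a b \<epsilon> g] \<open>p > 0\<close> assms(6,7) A \<epsilon> \<delta> e
      unfolding I_def e_def K_def by blast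
    have "Ch_norm \<nu> I p w h \<le> ennreal (\<delta> * (k + 1))"
      using norm K \<delta> by (simp add: ennreal_mult[symmetric] order_trans ennreal_leI algebra_simps)
    moreover have "ennreal (\<epsilon> * m) \<le> abs_integral I (\<lambda>x. h x * g x)"
      using pair m \<epsilon>(1) by (simp add: ennreal_mult)
    ultimately have "ennreal (\<epsilon> * m) / ennreal (\<delta> * (k + 1))
        \<le> abs_integral I (\<lambda>x. h x * g x) / Ch_norm \<nu> I p w h"
      by (intro ennreal_divide_mono)
    also have "ennreal (\<epsilon> * m) / ennreal (\<delta> * (k + 1)) = ennreal r"
      using \<epsilon>(1) m(2) K(2) \<open>r > 0\<close> \<delta> by (simp add: divide_ennreal \<delta>_def)
    also have "abs_integral I (\<lambda>x. h x * g x) / Ch_norm \<nu> I p w h \<le> J_Ch \<nu> I p w g"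
      unfolding J_Ch_def by (rule SUP_upper) (use h in simp)
    finally show ?thesis .
  qed
  note ge = this
  show ?thesis
  proof (rule ccontr)
    assume "J_Ch \<nu> I p w g \<noteq> \<infinity>"
    then obtain x where "J_Ch \<nu> I p w g = ennreal x" "x \<ge> 0"
      by (cases "J_Ch \<nu> I p w g") auto
    with ge[of "x + 1"] show False by simp
  qed
qed

end
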